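(* Let $F_0=\mathtt{b}$, $F_1=\mathtt{a}$, and $F_{n+2}=F_{n+1}\cdot F_n$ for all $n\ge0$, and let $L=\{F_{4i+3}\mid i\ge0\}$. Then $L=\mathcal{L}(\beta)$ holds for the deterministic regex $$\beta=\mathtt{a}\,\langle x_0:\mathtt{b}\rangle\langle x_1:\mathtt{a}\rangle\cdot(\beta_{\mathsf{shift}})^*,$$ $$\beta_{\mathsf{shift}}=\langle x_2:\&x_1\,\&x_0\rangle\,\langle x_3:\&x_1\,\&x_0\,\&x_1\rangle\,\langle x_0:\&x_3\,\&x_2\rangle\,\langle x_1:\&x_3\,\&x_2\,\&x_3\rangle .$$
   Context: Regex. Let $\Sigma$ be a finite terminal alphabet ($|\Sigma|\ge 2$ unless otherwise noted) and $\Xi$ an infinite variable alphabet disjoint from $\Sigma$. The set $\mathsf{RX}$ of regex, with $\mathsf{var}(\alpha)\subset\Xi$ the set of variables occurring in $\alpha$, is defined recursively: every $a\in\Sigma\cup\{\varepsilon\}$ is a regex; $\&x$ (variable reference) for $x\in\Xi$; $(\alpha\cdot\beta)$, $(\alpha\vee\beta)$, $(\alpha^+)$ for $\alpha,\beta\in\mathsf{RX}$; and $\langle x:\alpha\rangle$ (variable binding) for $\alpha\in\mathsf{RX}$ and $x\in\Xi\setminus\mathsf{var}(\alpha)$. Also $\emptyset$ is a regex, but may not occur inside another regex. $\alpha^*$ abbreviates $\varepsilon\vee\alpha^+$; a nonempty set $A\subseteq\Sigma$ abbreviates $\bigvee_{a\in A}a$. Let $\Gamma=\{[_x,]_x\mid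 x\in\Xi\}$. The ref-language $\mathcal{R}(\alpha)\subseteq(\Sigma\cup\Xi\cup\Gamma)^*$ is given by $\mathcal{R}(\emptyset)=\emptyset$, $\mathcal{R}(a)=\{a\}$ for $a\in\Sigma\cup\{\varepsilon\}$, $\mathcal{R}(\&x)=\{x\}$, $\mathcal{R}(\langle x:\alpha\rangle)=[_x\mathcal{R}(\alpha)]_x$, $\mathcal{R}(\alpha\cdot\beta)=\mathcal{R}(\alpha)\mathcal{R}(\beta)$, $\mathcal{R}(\alpha\vee\beta)=\mathcal{R}(\alpha)\cup\mathcal{R}(\beta)$, $\mathcal{R}(\alpha^+)=\mathcal{R}(\alpha)^+$. For $r\in\mathcal{R}(\alpha)$, the dereference $\mathcal{D}(r)\in\Sigma^*$ is obtained by replacing each occurrence of a variable $x$ by $v$, where $[_x v]_x$ is the nearest such factor to the left of this occurrence (or by $\varepsilon$ if there is none; variables inside $v$ are replaced likewise), and then deleting all symbols of $\Gamma$. $\mathcal{L}(\alpha)=\{\mathcal{D}(r)\mid r\in\mathcal{R}(\alpha)\}$. Deterministic regex. Let $\alpha_{\mathcal{R}}$ be the regular expression over $\Sigma\cup\Xi\cup\Gamma$ obtained from $\alpha$ by replacing each $\langle x:\beta\rangle$ by $[_x\beta_{\mathcal{R}}]_x$ and each $\&x$ by $x$. The marked regex $\tilde\alpha$ is obtained from $\alpha_{\mathcal{R}}$ by attaching to each occurrence of a symbol $\chi\in\Sigma\cup\Xi\cup\Gamma$ its own unique number $i$, written $\chi_{(i)}$; $\mathcal{R}(\tilde\alpha)$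 is the language of marked ref-words it generates. $\tilde A$ denotes the set of marked symbols from $A$. A regex $\alpha$ is not deterministic if there exist $\rho_1,\rho_2\in\mathcal{R}(\tilde\alpha)$, $r,s_1,s_2\in(\tilde\Sigma\cup\tilde\Xi\cup\tilde\Gamma)^*$ and $\gamma_1,\gamma_2\in\tilde\Gamma^*$ such that one of the following holds: (1) $\rho_1=r\gamma_1a_{(i)}s_1$ and $\rho_2=r\gamma_2a_{(j)}s_2$ with $a\in\Sigma$, $i\ne j$; (2) $\rho_1=r\gamma_1x_{(i)}s_1$ and $\rho_2=r\gamma_2\chi_{(j)}s_2$ with $x\in\Xi$, $\chi\in\Sigma\cup\Xi$, $i\neq j$; (3) $\rho_1=r\gamma_1\chi_{(i)}s_1$ and $\rho_2=r\gamma_2\chi_{(i)}s_2$ with $\chi\in\Sigma\cup\Xi$, $\gamma_1\ne\gamma_2$; (4) $\rho_1=r\gamma_1$ and $\rho_2=r\gamma_2$ with $\gamma_1\neq\gamma_2$. Otherwise $\alpha$ is deterministic. *)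

theory Defs
  imports Main "HOL-Library.Infinite_Typeclass"
begin

section \<open>Regex\<close>

text \<open>
  The terminal alphabet and the variable alphabet are the types \<open>'a\<close> and \<open>'x\<close>. The set function
  \<open>var\<close> collects variables from references and from bindings. The datatype is larger than the set
  \<open>RX\<close> below: it does not enforce the side conditions on bindings and on the empty regex.
\<close>

datatype ('a, var: 'x) regex =
    Empty
  | Eps
  | Letter 'a
  | Ref 'x
  | Cat "('a, 'x) regex" "('a, 'x) regex"  (infixr \<open>\<cdot>\<close> 75)
  | Alt "('a, 'x) regex" "('a, 'x) regex"
  | Iter "('a, 'x) regex"
  | Bind 'x "('a, 'x) regex"

abbreviation Star :: "('a, 'x) regex \<Rightarrow> ('a, 'x) regex" where
  "Star \<alpha> \<equiv> Alt Eps (Iter \<alpha>)"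

inductive_set nonempty_RX :: "('a, 'x) regex set" where
  "Eps \<in> nonempty_RX"
| "Letter a \<in> nonempty_RX"
| "Ref x \<in> nonempty_RX"
| "\<alpha> \<in> nonempty_RX \<Longrightarrow> \<beta> \<in> nonempty_RX \<Longrightarrow> \<alpha> \<cdot> \<beta> \<in> nonempty_RX"
| "\<alpha> \<in> nonempty_RX \<Longrightarrow> \<beta> \<in> nonempty_RX \<Longrightarrow> Alt \<alpha> \<beta> \<in> nonempty_RX"
| "\<alpha> \<in> nonempty_RX \<Longrightarrow> Iter \<alpha> \<in> nonempty_RX"
| "\<alpha> \<in> nonempty_RX \<Longrightarrow> x \<notin> var \<alpha> \<Longrightarrow> Bind x \<alpha> \<in> nonempty_RX"

definition RX :: "('a, 'x) regex set" where
  "RX = insert Empty nonempty_RX"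


section \<open>Ref-words and the language of a regex\<close>

datatype ('a, 'x) symb = Ltr 'a | Var 'x | Open 'x | Close 'x

abbreviation \<Sigma> :: "('a, 'x) symb set" where "\<Sigma> \<equiv> range Ltr"
abbreviation \<Xi> :: "('a, 'x) symb set" where "\<Xi> \<equiv> range Var"
abbreviation \<Gamma> :: "('a, 'x) symb set" where "\<Gamma> \<equiv> range Open \<union> range Close"

definition conc :: "'s list set \<Rightarrow> 's list set \<Rightarrow> 's list set"  (infixr \<open>@@\<close> 75) where
  "A @@ B = {u @ v | u v. u \<in> A \<and> v \<in> B}"

definition iter :: "'s list set \<Rightarrow> 's list set" where
  "iter A = {concat ws | ws. ws \<noteq> [] \<and> set ws \<subseteq> A}"

fun ref_lang :: "('a, 'x) regex \<Rightarrow> ('a, 'x) symb list set" where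
  "ref_lang Empty = {}"
| "ref_lang Eps = {[]}"
| "ref_lang (Letter a) = {[Ltr a]}"
| "ref_lang (Ref x) = {[Var x]}"
| "ref_lang (\<alpha> \<cdot> \<beta>) = ref_lang \<alpha> @@ ref_lang \<beta>"
| "ref_lang (Alt \<alpha> \<beta>) = ref_lang \<alpha> \<union> ref_lang \<beta>"
| "ref_lang (Iter \<alpha>) = iter (ref_lang \<alpha>)"
| "ref_lang (Bind x \<alpha>) = {[Open x]} @@ ref_lang \<alpha> @@ {[Close x]}"

text \<open>Split a word around the last occurrence of a symbol.\<close>

fun split_last :: "'s \<Rightarrow> 's list \<Rightarrow> ('s list \<times> 's list) option" where
  "split_last c [] = None"
| "split_last c (s # w) =
     (case split_last c w of
        Some (p, q) \<Rightarrow> Some (s # p, q)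
      | None \<Rightarrow> if s = c then Some ([], w) else None)"

lemma split_last_eq_None_iff: "split_last c w = None \<longleftrightarrow> c \<notin> set w"
  by (induction w) (auto split: option.splits)

lemma split_last_eq_Some_iff:
  "split_last c w = Some (p, q) \<longleftrightarrow> w = p @ c # q \<and> c \<notin> set q"
proof (induction w arbitrary: p)
  case Nil
  then show ?case by simp
next
  case (Cons s w)
  show ?case
  proof (cases p)
    case Nil
    then show ?thesis
      using split_last_eq_None_iff[of c w] by (auto split: option.splits)
  next
    case (Cons t p')
    then show ?thesis
      using Cons.IH[of p'] by (auto split: option.splits simp: split_last_eq_None_iff)
  qed
qed

text \<open>
  If \<open>nearest_factor x u = Some (p, v)\<close>, then \<open>p @ Open x # v @ Close x # q = u\<close> for some \<open>q\<close>, the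
  factor displayed being the rightmost factor of \<open>u\<close> of this shape: it ends at the last \<open>Close x\<close> and
  starts at the last \<open>Open x\<close> before that. The result is \<open>None\<close> if and only if \<open>u\<close> has no such factor.
\<close>

definition nearest_factor ::
    "'x \<Rightarrow> ('a, 'x) symb list \<Rightarrow> (('a, 'x) symb list \<times> ('a, 'x) symb list) option" where
  "nearest_factor x u =
     (case split_last (Close x) u of
        None \<Rightarrow> None
      | Some (p, _) \<Rightarrow> split_last (Open x) p)"

lemma nearest_factor_eq_Some_iff:
  "nearest_factor x u = Some (p, v) \<longleftrightarrow>
     (\<exists>q. u = p @ Open x # v @ Close x # q \<and> Open x \<notin> set v \<and> Close x \<notin> set q)"
proof -
  have "nearest_factor x u = Some (p, v) \<longleftrightarrow>
      (\<exists>p' q. split_last (Close x) u = Some (p', q) \<and> split_last (Open x) p' = Some (p, v))"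
    by (auto simp: nearest_factor_def split: option.splits)
  also have "\<dots> \<longleftrightarrow> (\<exists>q. u = p @ Open x # v @ Close x # q \<and> Open x \<notin> set v \<and> Close x \<notin> set q)"
    by (auto simp: split_last_eq_Some_iff)
  finally show ?thesis .
qed

lemma nearest_factor_eq_None_iff:
  "nearest_factor x u = None \<longleftrightarrow> (\<nexists>p v q. u = p @ Open x # v @ Close x # q)"
proof
  assume None: "nearest_factor x u = None"
  show "\<nexists>p v q. u = p @ Open x # v @ Close x # q"
  proof clarify
    fix p v q
    assume u: "u = p @ Open x # v @ Close x # q"
    then obtain p' q' where split: "split_last (Close x) u = Some (p', q')"
      by (cases "split_last (Close x) u") (auto simp: split_last_eq_None_iff)
    then have "u = p' @ Close x # q'" "Close x \<notin> set q'"
      by (simp_all add: split_last_eq_Some_iff)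
    moreover have "Open x \<notin> set p'"
      using None split by (simp add: nearest_factor_def split_last_eq_None_iff)
    ultimately show False
      using u by (auto simp: append_eq_append_conv2 append_eq_Cons_conv Cons_eq_append_conv)
  qed
next
  assume "\<nexists>p v q. u = p @ Open x # v @ Close x # q"
  then show "nearest_factor x u = None"
    by (metis nearest_factor_eq_Some_iff not_None_eq surj_pair)
qed

text \<open>
  \<open>deref_after u w\<close> dereferences the factor \<open>w\<close> of a ref-word in which \<open>u\<close> is the prefix preceding
  \<open>w\<close>. An occurrence of a variable inside a binding is thus resolved relative to its own position in
  the ref-word, so the value of a variable is fixed at the point where it is bound.
\<close>

function deref_after :: "('a, 'x) symb list \<Rightarrow> ('a, 'x) symb list \<Rightarrow> 'a list" where
  "deref_after u [] = []"
| "deref_after u (Ltr a # w) = a # deref_after (u @ [Ltr a]) w"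
| "deref_after u (Open x # w) = deref_after (u @ [Open x]) w"
| "deref_after u (Close x # w) = deref_after (u @ [Close x]) w"
| "deref_after u (Var x # w) =
     (case nearest_factor x u of
        None \<Rightarrow> []
      | Some (p, v) \<Rightarrow> deref_after (p @ [Open x]) v)
     @ deref_after (u @ [Var x]) w"
  by pat_completeness auto
termination
  by (relation "(\<lambda>(u, w). length u + length w) <*mlex*> measure (\<lambda>(u, w). length w)")
    (auto simp: mlex_prod_def nearest_factor_eq_Some_iff wf_mlex)

definition deref :: "('a, 'x) symb list \<Rightarrow> 'a list" where
  "deref r = deref_after [] r"

definition lang :: "('a, 'x) regex \<Rightarrow> 'a list set" where
  "lang \<alpha> = deref ` ref_lang \<alpha>"


section \<open>Deterministic regex\<close>

datatype 's rexp =
    REmpty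
  | REps
  | RAtom 's
  | RCat "'s rexp" "'s rexp"
  | RAlt "'s rexp" "'s rexp"
  | RIter "'s rexp"

fun rexp_lang :: "'s rexp \<Rightarrow> 's list set" where
  "rexp_lang REmpty = {}"
| "rexp_lang REps = {[]}"
| "rexp_lang (RAtom s) = {[s]}"
| "rexp_lang (RCat e f) = rexp_lang e @@ rexp_lang f"
| "rexp_lang (RAlt e f) = rexp_lang e \<union> rexp_lang f"
| "rexp_lang (RIter e) = iter (rexp_lang e)"

fun to_rexp :: "('a, 'x) regex \<Rightarrow> ('a, 'x) symb rexp" where
  "to_rexp Empty = REmpty"
| "to_rexp Eps = REps"
| "to_rexp (Letter a) = RAtom (Ltr a)"
| "to_rexp (Ref x) = RAtom (Var x)"
| "to_rexp (\<alpha> \<cdot> \<beta>) = RCat (to_rexp \<alpha>) (to_rexp \<beta>)"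
| "to_rexp (Alt \<alpha> \<beta>) = RAlt (to_rexp \<alpha>) (to_rexp \<beta>)"
| "to_rexp (Iter \<alpha>) = RIter (to_rexp \<alpha>)"
| "to_rexp (Bind x \<alpha>) = RCat (RAtom (Open x)) (RCat (to_rexp \<alpha>) (RAtom (Close x)))"

lemma rexp_lang_to_rexp: "rexp_lang (to_rexp \<alpha>) = ref_lang \<alpha>"
  by (induction \<alpha>) auto

fun atoms :: "'s rexp \<Rightarrow> 's list" where
  "atoms REmpty = []"
| "atoms REps = []"
| "atoms (RAtom s) = [s]"
| "atoms (RCat e f) = atoms e @ atoms f"
| "atoms (RAlt e f) = atoms e @ atoms f"
| "atoms (RIter e) = atoms e"

text \<open>\<open>number n e\<close> numbers the symbol occurrences of \<open>e\<close> from left to right, starting with \<open>n\<close>.\<close>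

fun number :: "nat \<Rightarrow> 's rexp \<Rightarrow> ('s \<times> nat) rexp" where
  "number n REmpty = REmpty"
| "number n REps = REps"
| "number n (RAtom s) = RAtom (s, n)"
| "number n (RCat e f) = RCat (number n e) (number (n + length (atoms e)) f)"
| "number n (RAlt e f) = RAlt (number n e) (number (n + length (atoms e)) f)"
| "number n (RIter e) = RIter (number n e)"

lemma atoms_number: "atoms (number n e) = zip (atoms e) [n..<n + length (atoms e)]"
proof -
  have "[n..<n + (j + k)] = [n..<n + j] @ [n + j..<n + j + k]" for n j k :: nat
    using upt_add_eq_append[of n "n + j" k] by (simp add: add.assoc)
  then show ?thesis
    by (induction e arbitrary: n) simp_all
qed

definition marked :: "('a, 'x) regex \<Rightarrow> (('a, 'x) symb \<times> nat) rexp" where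
  "marked \<alpha> = number 0 (to_rexp \<alpha>)"

definition deterministic :: "('a, 'x) regex \<Rightarrow> bool" where
  "deterministic \<alpha> \<longleftrightarrow>
     \<not> (\<exists>\<rho>\<^sub>1 \<in> rexp_lang (marked \<alpha>). \<exists>\<rho>\<^sub>2 \<in> rexp_lang (marked \<alpha>).
        \<exists>r s\<^sub>1 s\<^sub>2. \<exists>\<gamma>\<^sub>1 \<in> lists (\<Gamma> \<times> UNIV). \<exists>\<gamma>\<^sub>2 \<in> lists (\<Gamma> \<times> UNIV).
          (\<exists>a \<in> \<Sigma>. \<exists>i j. \<rho>\<^sub>1 = r @ \<gamma>\<^sub>1 @ (a, i) # s\<^sub>1 \<and> \<rho>\<^sub>2 = r @ \<gamma>\<^sub>2 @ (a, j) # s\<^sub>2 \<and> i \<noteq> j) \<or>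
          (\<exists>x \<in> \<Xi>. \<exists>\<chi> \<in> \<Sigma> \<union> \<Xi>. \<exists>i j.
             \<rho>\<^sub>1 = r @ \<gamma>\<^sub>1 @ (x, i) # s\<^sub>1 \<and> \<rho>\<^sub>2 = r @ \<gamma>\<^sub>2 @ (\<chi>, j) # s\<^sub>2 \<and> i \<noteq> j) \<or>
          (\<exists>\<chi> \<in> \<Sigma> \<union> \<Xi>. \<exists>i.
             \<rho>\<^sub>1 = r @ \<gamma>\<^sub>1 @ (\<chi>, i) # s\<^sub>1 \<and> \<rho>\<^sub>2 = r @ \<gamma>\<^sub>2 @ (\<chi>, i) # s\<^sub>2 \<and> \<gamma>\<^sub>1 \<noteq> \<gamma>\<^sub>2) \<or>
          (\<rho>\<^sub>1 = r @ \<gamma>\<^sub>1 \<and> \<rho>\<^sub>2 = r @ \<gamma>\<^sub>2 \<and> \<gamma>\<^sub>1 \<noteq> \<gamma>\<^sub>2))"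


section \<open>Fibonacci words\<close>

fun fib_word :: "'a \<Rightarrow> 'a \<Rightarrow> nat \<Rightarrow> 'a list" where
  "fib_word a b 0 = [b]"
| "fib_word a b (Suc 0) = [a]"
| "fib_word a b (Suc (Suc n)) = fib_word a b (Suc n) @ fib_word a b n"

end

theory Submission
  imports Defs "HOL-Library.Countable_Complete_Lattices"
begin

text \<open>
  The marked ref-words of \<open>\<beta>\<close> are \<open>P @ concat (replicate k S)\<close> for two fixed words \<open>P\<close> and \<open>S\<close>, so any
  two of them are comparable in the prefix order, and \<open>S\<close> is not made of brackets alone. This rules
  out all four ways of violating determinism.

  If \<open>x\<^sub>0\<close> and \<open>x\<^sub>1\<close> hold \<open>F\<^sub>n\<close> and \<open>F\<^sub>n\<^sub>+\<^sub>1\<close>, then one pass through \<open>\<beta>_shift\<close> produces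
  \<open>F\<^sub>n\<^sub>+\<^sub>2 F\<^sub>n\<^sub>+\<^sub>3 F\<^sub>n\<^sub>+\<^sub>4 F\<^sub>n\<^sub>+\<^sub>5\<close> and leaves \<open>F\<^sub>n\<^sub>+\<^sub>4\<close> and \<open>F\<^sub>n\<^sub>+\<^sub>5\<close> in these variables. Appended to \<open>F\<^sub>n\<^sub>+\<^sub>3\<close>, this
  yields \<open>F\<^sub>n\<^sub>+\<^sub>7\<close>, because each of the four words extends the word built so far to the next one.
\<close>

section \<open>Languages of single words and their iterations\<close>

lemma conc_singletons [simp]: "{u} @@ {v} = {u @ v}"
  by (auto simp: conc_def)

text \<open>Used from right to left: once grouped to the left, adjacent one-word languages merge by
  \<open>conc_singletons\<close>.\<close>

lemma conc_assoc: "(A @@ B) @@ C = A @@ B @@ C"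
  unfolding conc_def by (auto, (metis append_assoc)+)

lemma iter_singleton: "iter {w} = {concat (replicate (Suc k) w) | k. True}"
proof -
  have "ws \<noteq> [] \<and> set ws \<subseteq> {w} \<longleftrightarrow> (\<exists>k. ws = replicate (Suc k) w)" for ws
  proof
    assume "ws \<noteq> [] \<and> set ws \<subseteq> {w}"
    then have "ws = replicate (length ws) w" "length ws = Suc (length ws - 1)"
      by (auto simp: replicate_length_same[symmetric] subset_iff)
    then show "\<exists>k. ws = replicate (Suc k) w" by metis
  qed auto
  then have "{ws. ws \<noteq> [] \<and> set ws \<subseteq> {w}} = range (\<lambda>k. replicate (Suc k) w)"
    by (simp only: full_SetCompr_eq)
  then show ?thesis
    unfolding iter_def setcompr_eq_image by (simp only: image_image Collect_const if_True)
qed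

text \<open>The left side is what simplification makes of \<open>Star\<close> over a one-word
  language; \<open>k = 0\<close> supplies the empty word.\<close>

lemma star_singleton: "insert [] (iter {w}) = {concat (replicate k w) | k. True}"
proof -
  have "range f = insert (f 0) (range (\<lambda>k. f (Suc k)))" for f :: "nat \<Rightarrow> 'a list"
    by (subst UNIV_nat_eq) (simp only: image_insert image_image)
  from this[of "\<lambda>k. concat (replicate k w)"] show ?thesis
    by (simp add: iter_singleton full_SetCompr_eq)
qed

lemma conc_singleton_star: "{p} @@ insert [] (iter {w}) = {p @ concat (replicate k w) | k. True}"
  unfolding star_singleton by (auto simp: conc_def)


section \<open>Determinism\<close>

text \<open>The first symbol outside \<open>A\<close> marks where the initial block over
  \<open>A\<close> ends, and both sides are the same word.\<close>

lemma append_Cons_eq_imp_eq: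
  assumes "us @ x # xs = vs @ y # ys"
    and "set us \<subseteq> A" "set vs \<subseteq> A" "x \<notin> A" "y \<notin> A"
  shows "us = vs \<and> x = y"
  using assms
proof (induction us arbitrary: vs)
  case Nil
  then show ?case by (cases vs) auto
next
  case (Cons u us)
  then show ?case by (cases vs) auto
qed

text \<open>Comparable words agree on the first non-bracket symbol after \<open>r\<close> and on the
  brackets before it, which excludes the first three kinds of violation. The condition on
  \<open>w\<close> excludes the fourth, where one word would extend another by brackets
  alone.\<close>

lemma deterministicI:
  fixes \<alpha> :: "('a, 'x) regex"
  assumes comparable: "\<And>u v. u \<in> rexp_lang (marked \<alpha>) \<Longrightarrow> v \<in> rexp_lang (marked \<alpha>) \<Longrightarrow>
      \<exists>w. (u = v @ w \<or> v = u @ w) \<and> (w = [] \<or> w \<notin> lists (\<Gamma> \<times> UNIV))"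
  shows "deterministic \<alpha>"
proof -
  have letter: "\<gamma>\<^sub>1 = \<gamma>\<^sub>2 \<and> c = d"
    if prefixes: "r @ \<gamma>\<^sub>1 @ c # s\<^sub>1 \<in> rexp_lang (marked \<alpha>)" "r @ \<gamma>\<^sub>2 @ d # s\<^sub>2 \<in> rexp_lang (marked \<alpha>)"
      and brackets: "\<gamma>\<^sub>1 \<in> lists (\<Gamma> \<times> UNIV)" "\<gamma>\<^sub>2 \<in> lists (\<Gamma> \<times> UNIV)"
      and symbols: "fst c \<in> \<Sigma> \<union> \<Xi>" "fst d \<in> \<Sigma> \<union> \<Xi>"
    for r \<gamma>\<^sub>1 \<gamma>\<^sub>2 s\<^sub>1 s\<^sub>2 and c d :: "('a, 'x) symb \<times> nat"
  proof -
    obtain w where "\<gamma>\<^sub>1 @ c # s\<^sub>1 = \<gamma>\<^sub>2 @ d # s\<^sub>2 @ w \<or> \<gamma>\<^sub>2 @ d # s\<^sub>2 = \<gamma>\<^sub>1 @ c # s\<^sub>1 @ w"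
      using comparable[OF prefixes] by auto
    moreover have "c \<notin> \<Gamma> \<times> UNIV" "d \<notin> \<Gamma> \<times> UNIV"
      using symbols by (auto simp: mem_Times_iff)
    moreover have "set \<gamma>\<^sub>1 \<subseteq> \<Gamma> \<times> UNIV" "set \<gamma>\<^sub>2 \<subseteq> \<Gamma> \<times> UNIV"
      using brackets by (simp_all only: lists_eq_set mem_Collect_eq)
    ultimately show ?thesis
      by (metis append_Cons_eq_imp_eq)
  qed
  have final: "\<gamma>\<^sub>1 = \<gamma>\<^sub>2"
    if prefixes: "r @ \<gamma>\<^sub>1 \<in> rexp_lang (marked \<alpha>)" "r @ \<gamma>\<^sub>2 \<in> rexp_lang (marked \<alpha>)"
      and brackets: "\<gamma>\<^sub>1 \<in> lists (\<Gamma> \<times> UNIV)" "\<gamma>\<^sub>2 \<in> lists (\<Gamma> \<times> UNIV)"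
    for r \<gamma>\<^sub>1 \<gamma>\<^sub>2
  proof -
    obtain w where "\<gamma>\<^sub>1 = \<gamma>\<^sub>2 @ w \<or> \<gamma>\<^sub>2 = \<gamma>\<^sub>1 @ w" "w = [] \<or> w \<notin> lists (\<Gamma> \<times> UNIV)"
      using comparable[OF prefixes] by (metis append_assoc same_append_eq)
    \<comment> \<open>As a suffix of a bracket word, \<open>w\<close> consists of brackets, hence is
      empty.\<close>
    then show ?thesis
      using brackets by (metis append_in_lists_conv append_Nil2)
  qed
  show ?thesis
    unfolding deterministic_def
  proof (intro notI, elim bexE exE disjE conjE, goal_cases)
    case (1 \<rho>\<^sub>1 \<rho>\<^sub>2 r s\<^sub>1 s\<^sub>2 \<gamma>\<^sub>1 \<gamma>\<^sub>2 c i j)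
    then show ?case using letter[of r \<gamma>\<^sub>1 "(c, i)" s\<^sub>1 \<gamma>\<^sub>2 "(c, j)" s\<^sub>2] by simp
  next
    case (2 \<rho>\<^sub>1 \<rho>\<^sub>2 r s\<^sub>1 s\<^sub>2 \<gamma>\<^sub>1 \<gamma>\<^sub>2 x \<chi> i j)
    then show ?case using letter[of r \<gamma>\<^sub>1 "(x, i)" s\<^sub>1 \<gamma>\<^sub>2 "(\<chi>, j)" s\<^sub>2] by simp
  next
    case (3 \<rho>\<^sub>1 \<rho>\<^sub>2 r s\<^sub>1 s\<^sub>2 \<gamma>\<^sub>1 \<gamma>\<^sub>2 \<chi> i)
    then show ?case using letter[of r \<gamma>\<^sub>1 "(\<chi>, i)" s\<^sub>1 \<gamma>\<^sub>2 "(\<chi>, i)" s\<^sub>2] by simp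
  next
    case (4 \<rho>\<^sub>1 \<rho>\<^sub>2 r s\<^sub>1 s\<^sub>2 \<gamma>\<^sub>1 \<gamma>\<^sub>2)
    then show ?case using final[of r \<gamma>\<^sub>1 \<gamma>\<^sub>2] by simp
  qed
qed

lemma concat_replicate_prefix:
  assumes "k \<le> l"
  shows "concat (replicate l w) = concat (replicate k w) @ concat (replicate (l - k) w)"
  using assms by (simp flip: concat_append replicate_add)

lemma deterministic_if_marked_single_loop:
  assumes lang: "rexp_lang (marked \<alpha>) = {p @ concat (replicate k w) | k. True}"
    and loop: "w \<notin> lists (\<Gamma> \<times> UNIV)"
  shows "deterministic \<alpha>"
proof (rule deterministicI)
  fix u v
  assume "u \<in> rexp_lang (marked \<alpha>)" "v \<in> rexp_lang (marked \<alpha>)"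
  then obtain k l where u: "u = p @ concat (replicate k w)" and v: "v = p @ concat (replicate l w)"
    unfolding lang by blast
  have loops: "concat (replicate n w) = [] \<or> concat (replicate n w) \<notin> lists (\<Gamma> \<times> UNIV)" for n
    using loop by (cases n) auto
  show "\<exists>w. (u = v @ w \<or> v = u @ w) \<and> (w = [] \<or> w \<notin> lists (\<Gamma> \<times> UNIV))"
  proof (cases "k \<le> l")
    case True
    then have "v = u @ concat (replicate (l - k) w)"
      using u v by (simp add: concat_replicate_prefix)
    then show ?thesis using loops by blast
  next
    case False
    then have "u = v @ concat (replicate (k - l) w)"
      using u v by (simp add: concat_replicate_prefix)
    then show ?thesis using loops by blast
  qed
qed


section \<open>Dereferencing with the values of the variables\<close>

text \<open>Naming the lookup turns a context into a valuation, which bindings update like a program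
  state.\<close>

definition val :: "('a, 'x) symb list \<Rightarrow> 'x \<Rightarrow> 'a list" where
  "val u x = (case nearest_factor x u of None \<Rightarrow> [] | Some (p, v) \<Rightarrow> deref_after (p @ [Open x]) v)"

lemma deref_after_Var: "deref_after u (Var x # w) = val u x @ deref_after (u @ [Var x]) w"
  by (simp add: val_def)

declare deref_after.simps(5) [simp del] deref_after_Var [simp]

lemma deref_after_append: "deref_after u (v @ w) = deref_after u v @ deref_after (u @ v) w"
proof (induction v arbitrary: u)
  case (Cons s v)
  then show ?case by (cases s) simp_all
qed simp

text \<open>The search starts at the last \<open>Close x\<close>, which cannot lie in
  \<open>w\<close>, and never looks to its right.\<close>

lemma nearest_factor_append:
  assumes "Close x \<notin> set w"
  shows "nearest_factor x (u @ w) = nearest_factor x u"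
proof (cases "split_last (Close x) u")
  case None
  then have "split_last (Close x) (u @ w) = None"
    using assms by (simp add: split_last_eq_None_iff)
  then show ?thesis using None by (simp add: nearest_factor_def)
next
  case (Some pq)
  then obtain p q where pq: "split_last (Close x) u = Some (p, q)" by (cases pq) simp
  then have "split_last (Close x) (u @ w) = Some (p, q @ w)"
    using assms by (simp add: split_last_eq_Some_iff)
  then show ?thesis using pq by (simp add: nearest_factor_def)
qed

lemma val_append: "Close x \<notin> set w \<Longrightarrow> val (u @ w) x = val u x"
  by (simp add: val_def nearest_factor_append)

fun subst_symb :: "('x \<Rightarrow> 'a list) \<Rightarrow> ('a, 'x) symb \<Rightarrow> 'a list" where
  "subst_symb f (Ltr a) = [a]"
| "subst_symb f (Var x) = f x"
| "subst_symb f (Open x) = []"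
| "subst_symb f (Close x) = []"

text \<open>Values change only at closing brackets, so all references in \<open>v\<close> see the
  valuation at its start.\<close>

lemma deref_after_no_brackets:
  assumes "set v \<subseteq> \<Sigma> \<union> \<Xi>"
  shows "deref_after u v = concat (map (subst_symb (val u)) v)"
  using assms
proof (induction v arbitrary: u)
  case (Cons s v)
  then have "val (u @ [s]) = val u"
    by (auto simp: val_append)
  then show ?case using Cons by auto
qed simp

definition binding :: "'x \<Rightarrow> ('a, 'x) symb list \<Rightarrow> ('a, 'x) symb list" where
  "binding x v = Open x # v @ [Close x]"

lemma deref_after_binding:
  assumes "set v \<subseteq> \<Sigma> \<union> \<Xi>"
  shows "deref_after u (binding x v) = concat (map (subst_symb (val u)) v)"
proof -
  have "val (u @ [Open x]) = val u" by (auto simp: val_append)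
  then show ?thesis
    using assms by (simp add: binding_def deref_after_append deref_after_no_brackets)
qed

text \<open>Since \<open>v\<close> has no brackets, the new factor is the nearest one for
  \<open>x\<close>, and its references still see the values from \<open>u\<close>.\<close>

lemma val_binding:
  assumes "set v \<subseteq> \<Sigma> \<union> \<Xi>"
  shows "val (u @ binding x v) = (val u)(x := concat (map (subst_symb (val u)) v))"
proof
  fix y
  show "val (u @ binding x v) y = ((val u)(x := concat (map (subst_symb (val u)) v))) y"
  proof (cases "y = x")
    case True
    have "nearest_factor x (u @ binding x v) = Some (u, v)"
      unfolding nearest_factor_eq_Some_iff binding_def using assms by auto
    moreover have "val (u @ [Open x]) = val u" by (auto simp: val_append)
    ultimately show ?thesis
      using True assms by (simp add: val_def[of "u @ binding x v"] deref_after_no_brackets)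
  next
    case False
    then have "Close y \<notin> set (binding x v)" using assms by (auto simp: binding_def)
    then show ?thesis using False by (simp add: val_append)
  qed
qed


section \<open>Fibonacci words\<close>

text \<open>The only ref-word of \<open>\<beta>_shift\<close>.\<close>

definition shift_word :: "'x \<Rightarrow> 'x \<Rightarrow> 'x \<Rightarrow> 'x \<Rightarrow> ('a, 'x) symb list" where
  "shift_word x\<^sub>0 x\<^sub>1 x\<^sub>2 x\<^sub>3 =
     binding x\<^sub>2 [Var x\<^sub>1, Var x\<^sub>0] @ binding x\<^sub>3 [Var x\<^sub>1, Var x\<^sub>0, Var x\<^sub>1] @
     binding x\<^sub>0 [Var x\<^sub>3, Var x\<^sub>2] @ binding x\<^sub>1 [Var x\<^sub>3, Var x\<^sub>2, Var x\<^sub>3]"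

text \<open>The bindings store F(n+2), F(n+3), F(n+4), F(n+5) in turn. The last two read only
  \<open>x\<^sub>2\<close> and \<open>x\<^sub>3\<close>, so overwriting \<open>x\<^sub>0\<close>
  does no harm.\<close>

lemma shift_word_deref:
  assumes "distinct [x\<^sub>0, x\<^sub>1, x\<^sub>2, x\<^sub>3]"
    and "val u x\<^sub>0 = fib_word a b n" "val u x\<^sub>1 = fib_word a b (n + 1)"
  shows "fib_word a b (n + 3) @ deref_after u (shift_word x\<^sub>0 x\<^sub>1 x\<^sub>2 x\<^sub>3) = fib_word a b (n + 7)"
    and "val (u @ shift_word x\<^sub>0 x\<^sub>1 x\<^sub>2 x\<^sub>3) x\<^sub>0 = fib_word a b (n + 4)"
    and "val (u @ shift_word x\<^sub>0 x\<^sub>1 x\<^sub>2 x\<^sub>3) x\<^sub>1 = fib_word a b (n + 5)"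
proof -
  have "x\<^sub>1 \<noteq> x\<^sub>0" "x\<^sub>2 \<noteq> x\<^sub>0" "x\<^sub>3 \<noteq> x\<^sub>0" "x\<^sub>2 \<noteq> x\<^sub>1" "x\<^sub>3 \<noteq> x\<^sub>1" "x\<^sub>3 \<noteq> x\<^sub>2"
    using assms(1) by auto
  note deref_simps = this this[symmetric] shift_word_def deref_after_append deref_after_binding
    val_binding eval_nat_numeral assms(2,3)
  show "fib_word a b (n + 3) @ deref_after u (shift_word x\<^sub>0 x\<^sub>1 x\<^sub>2 x\<^sub>3) = fib_word a b (n + 7)"
    \<comment> \<open>Left-nested appends give contexts the form expected by
      \<open>val_binding\<close>, and give both sides, unfolded into F(n) and F(n+1), a common
      form.\<close>
    by (simp add: deref_simps flip: append_assoc)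
  show "val (u @ shift_word x\<^sub>0 x\<^sub>1 x\<^sub>2 x\<^sub>3) x\<^sub>0 = fib_word a b (n + 4)"
    "val (u @ shift_word x\<^sub>0 x\<^sub>1 x\<^sub>2 x\<^sub>3) x\<^sub>1 = fib_word a b (n + 5)"
    by (simp_all add: deref_simps flip: append_assoc)
qed

lemma shift_words_deref:
  assumes "distinct [x\<^sub>0, x\<^sub>1, x\<^sub>2, x\<^sub>3]"
    and "val u x\<^sub>0 = fib_word a b n" "val u x\<^sub>1 = fib_word a b (n + 1)"
  shows "fib_word a b (n + 3) @ deref_after u (concat (replicate k (shift_word x\<^sub>0 x\<^sub>1 x\<^sub>2 x\<^sub>3))) =
    fib_word a b (n + 4 * k + 3)"
  using assms
proof (induction k arbitrary: u n)
  case (Suc k)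
  let ?u = "u @ shift_word x\<^sub>0 x\<^sub>1 x\<^sub>2 x\<^sub>3"
  have "fib_word a b (n + 7) @ deref_after ?u (concat (replicate k (shift_word x\<^sub>0 x\<^sub>1 x\<^sub>2 x\<^sub>3))) =
      fib_word a b (n + 4 * Suc k + 3)"
    \<comment> \<open>One pass has turned the prefix F(n+3) into F(n+7), the prefix that the
      hypothesis needs at \<open>n + 4\<close>.\<close>
    using Suc.IH[of ?u "n + 4"] Suc.prems shift_word_deref[OF Suc.prems]
    by (simp add: algebra_simps)
  then show ?case
    using shift_word_deref(1)[OF Suc.prems] by (simp add: deref_after_append flip: append_assoc)
qed simp

theorem lemma3:
  fixes a b :: "'a::finite" and x\<^sub>0 x\<^sub>1 x\<^sub>2 x\<^sub>3 :: "'x::infinite"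
    and F :: "nat \<Rightarrow> 'a list" and L :: "'a list set"
    and \<beta> \<beta>_shift :: "('a, 'x) regex"
  assumes "a \<noteq> b" and "distinct [x\<^sub>0, x\<^sub>1, x\<^sub>2, x\<^sub>3]"
  defines "F \<equiv> fib_word a b"
  defines "L \<equiv> {F (4 * i + 3) | i. True}"
  defines "\<beta>_shift \<equiv>
      Bind x\<^sub>2 (Ref x\<^sub>1 \<cdot> Ref x\<^sub>0) \<cdot>
      Bind x\<^sub>3 (Ref x\<^sub>1 \<cdot> Ref x\<^sub>0 \<cdot> Ref x\<^sub>1) \<cdot>
      Bind x\<^sub>0 (Ref x\<^sub>3 \<cdot> Ref x\<^sub>2) \<cdot>
      Bind x\<^sub>1 (Ref x\<^sub>3 \<cdot> Ref x\<^sub>2 \<cdot> Ref x\<^sub>3)"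
  defines "\<beta> \<equiv> Letter a \<cdot> Bind x\<^sub>0 (Letter b) \<cdot> Bind x\<^sub>1 (Letter a) \<cdot> Star \<beta>_shift"
  shows "\<beta> \<in> RX \<and> deterministic \<beta> \<and> L = lang \<beta>"
proof (intro conjI)
  show "\<beta> \<in> RX"
    using assms(2) unfolding \<beta>_def \<beta>_shift_def RX_def
    by (auto intro!: nonempty_RX.intros)
next
  \<comment> \<open>Evaluating the marked language instantiates \<open>p\<close> and
    \<open>w\<close>; the marked references in \<open>w\<close> keep it from being all
    brackets.\<close>
  obtain p and w :: "(('a, 'x) symb \<times> nat) list"
    where "rexp_lang (marked \<beta>) = {p} @@ insert [] (iter {w})" and "w \<notin> lists (\<Gamma> \<times> UNIV)"
    by (rule that, simp add: \<beta>_def \<beta>_shift_def marked_def flip: conc_assoc) auto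
  then show "deterministic \<beta>"
    unfolding conc_singleton_star by (rule deterministic_if_marked_single_loop)
next
  define P :: "('a, 'x) symb list" where "P = [Ltr a] @ binding x\<^sub>0 [Ltr b] @ binding x\<^sub>1 [Ltr a]"
  let ?S = "shift_word x\<^sub>0 x\<^sub>1 x\<^sub>2 x\<^sub>3"
  have "ref_lang \<beta> = {P} @@ insert [] (iter {?S})"
    by (simp add: \<beta>_def \<beta>_shift_def P_def shift_word_def binding_def flip: conc_assoc)
  moreover have "deref (P @ concat (replicate k ?S)) = F (4 * k + 3)" for k
  proof -
    \<comment> \<open>\<open>P\<close> yields aba, which is F(3), so the passes start from n =
      0.\<close>
    have "deref_after [] P = fib_word a b 3" "val P x\<^sub>0 = fib_word a b 0" "val P x\<^sub>1 = fib_word a b 1"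
      using assms(2)
      by (simp_all add: P_def deref_after_append deref_after_binding val_binding eval_nat_numeral
          flip: append_assoc append_Cons)
    then show ?thesis
      using shift_words_deref[OF assms(2), of P a b 0 k]
      by (simp add: deref_def deref_after_append F_def)
  qed
  ultimately show "L = lang \<beta>"
    unfolding L_def lang_def conc_singleton_star setcompr_eq_image by (simp add: image_image)
qed

end
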